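(* Let $n\ge2$, $s_1,s_2\in(0,1)$, and let $$K_i^\ast(\zeta)=\frac{a_i(\overrightarrow\zeta)}{|\zeta|^{n+s_i}},\qquad i\in\{1,2\},$$ where $a_1,a_2$ are continuous functions on $\partial B_1$, bounded from above and below by two positive constants and satisfying $a_i(\omega)=a_i(-\omega)$ for all $\omega\in\partial B_1$. Let $\sigma\in\mathbb{R}$ and assume that either $s_1=s_2$, or $\sigma=0$. Let $H$ and $V$ be open half-spaces and let $\vartheta\in(0,\pi)$ be the angle between $H$ and $V$, that is $H\cap V=J_{0,\vartheta}$. Suppose that there exists $v\in H\cap\partial V$ such that $$\mathbf{H}^{K_1^\ast}_{\partial(H\cap V)}(v)-\int_{H^c}K_1^\ast(v-z)\,dz+\sigma\int_{H^c}K_2^\ast(v-z)\,dz=0.$$ Then $\vartheta$ and $\sigma$ satisfy the relation $$\int_{J_{\vartheta,\pi}}\frac{a_1(\overrightarrow{e(\vartheta)-x})}{|e(\vartheta)-x|^{n+s_1}}\,dx-\int_{J_{0,\vartheta}}\frac{a_1(\overrightarrow{e(\vartheta)-x})}{|e(\vartheta)-x|^{n+s_1}}\,dx+\sigma\int_{H^c}\frac{a_2(\overrightarrow{e(\vartheta)-x})}{|e(\vartheta)-x|^{n+s_1}}\,dx=0.$$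
   Context: $\overrightarrow\zeta:=\zeta/|\zeta|$; $e(\alpha):=\cos\alpha\,e_1+\sin\alpha\,e_n$; $F^c:=\mathbb{R}^n\setminus F$. For $0\le\vartheta_1<\vartheta_2<2\pi$, $J_{\vartheta_1,\vartheta_2}:=\{x\in\mathbb{R}^n:\exists\beta\in(\vartheta_1,\vartheta_2),\rho>0\text{ with }(x_1,x_n)=\rho(\cos\beta,\sin\beta)\}$. Coordinates are chosen so that $H=J_{0,\pi}=\{x_n>0\}$. For a set $F$ and $x\in\partial F$, $\mathbf{H}^K_{\partial F}(x):=\mathrm{p.v.}\int_{\mathbb{R}^n}K(x-y)\big(\chi_{F^c}(y)-\chi_F(y)\big)\,dy$ (principal value at $y=x$). The difference of the integrals over $J_{\vartheta,\pi}$ and $J_{0,\vartheta}$ is understood in the principal value sense, i.e. as the limit as $\rho\searrow0$ of the difference of the integrals over $J_{\vartheta,\pi}\setminus B_\rho(e(\vartheta))$ and $J_{0,\vartheta}\setminus B_\rho(e(\vartheta))$. *)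

theory Defs
  imports "HOL-Analysis.Analysis"
begin

text \<open>
  The ambient space is \<open>real ^ 'n\<close>. Two distinct indices \<open>p\<close> and \<open>q\<close> play the roles of
  the first and the last coordinate.
\<close>

definition edir :: "'n::finite \<Rightarrow> 'n \<Rightarrow> real \<Rightarrow> real ^ 'n" where
  "edir p q \<alpha> = cos \<alpha> *\<^sub>R axis p 1 + sin \<alpha> *\<^sub>R axis q 1"

definition sector :: "'n::finite \<Rightarrow> 'n \<Rightarrow> real \<Rightarrow> real \<Rightarrow> (real ^ 'n) set" where
  "sector p q \<theta>1 \<theta>2 =
     {x. \<exists>\<beta>\<in>{\<theta>1<..<\<theta>2}. \<exists>\<rho>>0. x $ p = \<rho> * cos \<beta> \<and> x $ q = \<rho> * sin \<beta>}"

definition open_halfspace :: "(real ^ 'n::finite) set \<Rightarrow> bool" where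
  "open_halfspace V \<longleftrightarrow> (\<exists>w b. w \<noteq> 0 \<and> V = {x. w \<bullet> x < b})"

definition admissible_density :: "(real ^ 'n::finite \<Rightarrow> real) \<Rightarrow> bool" where
  "admissible_density a \<longleftrightarrow>
     continuous_on (sphere 0 1) a \<and>
     (\<exists>c C. 0 < c \<and> 0 < C \<and> (\<forall>\<omega>\<in>sphere 0 1. c \<le> a \<omega> \<and> a \<omega> \<le> C)) \<and>
     (\<forall>\<omega>\<in>sphere 0 1. a \<omega> = a (- \<omega>))"

text \<open>The library's \<^const>\<open>sgn\<close> on vectors is the normalization \<open>\<zeta> \<mapsto> \<zeta> / norm \<zeta>\<close>.\<close>

definition hom_kernel :: "(real ^ 'n::finite \<Rightarrow> real) \<Rightarrow> real \<Rightarrow> real ^ 'n \<Rightarrow> real" where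
  "hom_kernel a s \<zeta> = a (sgn \<zeta>) / norm \<zeta> powr (real CARD('n) + s)"

text \<open>
  \<open>has_mean_curvature K F x h\<close>: the principal value integral defining the nonlocal
  \<open>K\<close>-mean curvature of the boundary of \<open>F\<close> at \<open>x\<close> converges, with value \<open>h\<close>.
\<close>

definition has_mean_curvature ::
  "(real ^ 'n::finite \<Rightarrow> real) \<Rightarrow> (real ^ 'n) set \<Rightarrow> real ^ 'n \<Rightarrow> real \<Rightarrow> bool" where
  "has_mean_curvature K F x h \<longleftrightarrow>
     ((\<lambda>\<rho>. LINT y:- ball x \<rho>|lborel. K (x - y) * (indicator (- F) y - indicator F y))
        \<longlongrightarrow> h) (at_right 0)"

end

theory Submission
  imports Defs
begin

text \<open>
  The point \<open>v\<close> lies on the face of the wedge \<open>S = H \<inter> V\<close> inside \<open>H\<close>, so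
  \<open>v = t + r e(\<theta>)\<close> with \<open>r > 0\<close> and \<open>t\<close> orthogonal to the two distinguished coordinates
  (\<open>frontier_point_on_ray\<close>). Up to the hyperplane that carries this face, the complement of \<open>S\<close>
  is the disjoint union of the opposite sector \<open>S'\<close> and of \<open>- H\<close>. The kernel is integrable off
  any ball about \<open>v\<close>, and \<open>- H\<close> keeps a positive distance from \<open>v\<close>. Hence, for small \<open>\<rho>\<close>, the
  truncated curvature integral is
  \[ \int_{S' - B_\rho(v)} K_1 - \int_{S - B_\rho(v)} K_1 + \int_{- H} K_1 \]
  (\<open>truncated_curvature_split\<close>). The last term is the one that the equation at \<open>v\<close> subtracts, so
  the difference of the first two converges as \<open>\<rho>\<close> tends to zero, and adding \<open>\<sigma> \<integral> K_2\<close> over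
  \<open>- H\<close> to its limit gives zero.

  The sets \<open>S\<close>, \<open>S'\<close> and \<open>- H\<close> are cones that are invariant under \<open>x \<mapsto> t + r x\<close>, a map taking
  \<open>e(\<theta>)\<close> to \<open>v\<close>. By homogeneity of the kernels, this change of variables turns each integral
  based at \<open>v\<close> into \<open>r powr (- s)\<close> times the integral based at \<open>e(\<theta>)\<close>
  (\<open>set_integral_hom_kernel_similarity\<close>). If \<open>s1 = s2\<close> the factor is the same in every term and
  cancels; if \<open>\<sigma> = 0\<close> the only term with a different factor is absent.
\<close>

section \<open>Affine change of variables and integrability away from a ball\<close>

lemma lborel_integral_affine:
  fixes f :: "'a::euclidean_space \<Rightarrow> real"
  assumes [measurable]: "f \<in> borel_measurable borel" and "c \<noteq> 0"
  shows "integral\<^sup>L lborel f = \<bar>c\<bar> ^ DIM('a) * (LINT x|lborel. f (t + c *\<^sub>R x))"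
  by (subst lborel_affine[OF \<open>c \<noteq> 0\<close>, of t])
     (simp add: integral_density integral_distr)

lemma lborel_integrable_affine:
  fixes f :: "'a::euclidean_space \<Rightarrow> real"
  assumes "integrable lborel f" and "c \<noteq> 0"
  shows "integrable lborel (\<lambda>x. f (t + c *\<^sub>R x))"
proof -
  have [measurable]: "f \<in> borel_measurable borel"
    using borel_measurable_integrable[OF assms(1)] by simp
  have "integrable (density (distr lborel borel (\<lambda>x. t + c *\<^sub>R x)) (\<lambda>_. \<bar>c\<bar>^DIM('a))) f"
    using assms(1) lborel_affine[OF \<open>c \<noteq> 0\<close>, of t] by metis
  then have "integrable (distr lborel borel (\<lambda>x. t + c *\<^sub>R x)) (\<lambda>x. \<bar>c\<bar>^DIM('a) *\<^sub>R f x)"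
    by (subst (asm) integrable_density) auto
  then have "integrable lborel (\<lambda>x. \<bar>c\<bar>^DIM('a) *\<^sub>R f (t + c *\<^sub>R x))"
    by (subst (asm) integrable_distr_eq) auto
  then show ?thesis using \<open>c \<noteq> 0\<close> by simp
qed

text \<open>
  Cover the exterior of the ball by dyadic shells of radius \<open>\<rho> 2\<^sup>k\<close>. On each shell the
  integrand is bounded by its value at the inner radius, while the volume grows like the
  \<open>DIM('a)\<close>-th power of the radius, so the shells contribute at most a geometric series of
  ratio \<open>2 powr (- s)\<close>.
\<close>
lemma set_integrable_norm_powr_outside_ball:
  fixes s \<rho> :: real
  assumes "s > 0" and "\<rho> > 0"
  shows "set_integrable lborel (- ball (0::'a::euclidean_space) \<rho>)
           (\<lambda>x. 1 / norm x powr (real DIM('a) + s))"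
proof -
  define d where "d = DIM('a)"
  define V where "V = measure lborel (ball (0::'a) 1)"
  \<comment> \<open>\<open>b k\<close> is the value of the integrand at the inner radius of the \<open>k\<close>-th shell.\<close>
  define b where "b k = 1 / (\<rho> * 2 ^ k) powr (real d + s)" for k :: nat
  define f where "f x = indicator (- ball 0 \<rho>) x * (1 / norm x powr (real d + s))" for x :: 'a
  have [measurable]: "f \<in> borel_measurable borel"
    unfolding f_def by measurable
  have b_nonneg: "b k \<ge> 0" for k
    by (simp add: b_def)
  have pointwise: "ennreal (norm (f x)) \<le> (\<Sum>k. ennreal (b k) * indicator (ball 0 (\<rho> * 2 ^ Suc k)) x)" for x
  proof (cases "norm x < \<rho>")
    case True
    then show ?thesis by (simp add: f_def)
  next
    case False
    then have x: "\<rho> \<le> norm x" by simp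
    obtain m0 :: nat where "norm x / \<rho> < 2 ^ m0"
      using real_arch_pow[of 2 "norm x / \<rho>"] by auto
    then have ex: "\<exists>m::nat. norm x < \<rho> * 2 ^ m"
      using \<open>\<rho> > 0\<close> by (auto simp: field_simps)
    \<comment> \<open>The shell that contains \<open>x\<close> is the one just below the first dyadic radius exceeding \<open>norm x\<close>.\<close>
    define m where "m = (LEAST m::nat. norm x < \<rho> * 2 ^ m)"
    have m: "norm x < \<rho> * 2 ^ m"
      unfolding m_def using ex by (rule LeastI_ex)
    with x have "m \<noteq> 0" by (cases m) auto
    then obtain k where k: "m = Suc k" by (cases m) auto
    have lower: "\<rho> * 2 ^ k \<le> norm x"
      using not_less_Least[of k "\<lambda>m. norm x < \<rho> * 2 ^ m"] k by (simp add: m_def not_less)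
    have "(\<rho> * 2 ^ k) powr (real d + s) \<le> norm x powr (real d + s)"
      using lower \<open>\<rho> > 0\<close> \<open>s > 0\<close> by (intro powr_mono2) auto
    then have "norm (f x) \<le> b k"
      using x \<open>\<rho> > 0\<close> by (auto simp: f_def b_def indicator_def intro!: divide_left_mono mult_pos_pos)
    then have "ennreal (norm (f x)) \<le> ennreal (b k) * indicator (ball 0 (\<rho> * 2 ^ Suc k)) x"
      using m k by (simp add: ennreal_leI)
    also have "\<dots> \<le> (\<Sum>k. ennreal (b k) * indicator (ball 0 (\<rho> * 2 ^ Suc k)) x)"
    proof -
      define g where "g k = ennreal (b k) * indicator (ball 0 (\<rho> * 2 ^ Suc k)) x" for k
      have "g k \<le> suminf g"
        using sum_le_suminf[of g "{k}"] by simp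
      then show ?thesis unfolding g_def .
    qed
    finally show ?thesis .
  qed
  have shell: "b k * measure lborel (ball (0::'a) (\<rho> * 2 ^ Suc k)) = 2 ^ d * V / \<rho> powr s * (1 / 2 powr s) ^ k" for k
  proof -
    have pos: "\<rho> * 2 ^ k > 0" using \<open>\<rho> > 0\<close> by simp
    have "measure lborel (ball (0::'a) (\<rho> * 2 ^ Suc k)) = (\<rho> * 2 ^ Suc k) ^ d * V"
      using \<open>\<rho> > 0\<close> unfolding d_def V_def by (subst content_ball_conv_unit_ball) auto
    also have "(\<rho> * 2 ^ Suc k) ^ d = 2 ^ d * (\<rho> * 2 ^ k) ^ d"
      by (simp add: power_mult_distrib mult_ac)
    finally have "measure lborel (ball (0::'a) (\<rho> * 2 ^ Suc k)) = 2 ^ d * (\<rho> * 2 ^ k) ^ d * V" .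
    moreover have "(\<rho> * 2 ^ k) powr (real d + s) = (\<rho> * 2 ^ k) ^ d * (\<rho> * 2 ^ k) powr s"
      using pos by (simp add: powr_add powr_realpow)
    moreover have "(\<rho> * 2 ^ k) powr s = \<rho> powr s * (2 powr s) ^ k"
      using \<open>\<rho> > 0\<close> by (simp add: powr_mult powr_realpow [symmetric] powr_powr mult.commute)
    ultimately show ?thesis
      using pos by (simp add: b_def power_divide)
  qed
  have "(\<integral>\<^sup>+x. ennreal (norm (f x)) \<partial>lborel)
          \<le> (\<integral>\<^sup>+x. (\<Sum>k. ennreal (b k) * indicator (ball 0 (\<rho> * 2 ^ Suc k)) x) \<partial>(lborel::'a measure))"
    by (intro nn_integral_mono pointwise)
  also have "\<dots> = (\<Sum>k. \<integral>\<^sup>+x. ennreal (b k) * indicator (ball 0 (\<rho> * 2 ^ Suc k)) x \<partial>(lborel::'a measure))"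
    by (rule nn_integral_suminf) (auto intro!: borel_measurable_times_ennreal borel_measurable_indicator)
  also have "\<dots> = (\<Sum>k. ennreal (2 ^ d * V / \<rho> powr s * (1 / 2 powr s) ^ k))"
  proof (intro suminf_cong)
    fix k
    have "(\<integral>\<^sup>+x. ennreal (b k) * indicator (ball 0 (\<rho> * 2 ^ Suc k)) x \<partial>(lborel::'a measure))
            = ennreal (b k) * emeasure lborel (ball (0::'a) (\<rho> * 2 ^ Suc k))"
      by (subst nn_integral_cmult_indicator) auto
    also have "emeasure lborel (ball (0::'a) (\<rho> * 2 ^ Suc k)) = ennreal (measure lborel (ball (0::'a) (\<rho> * 2 ^ Suc k)))"
      using emeasure_lborel_ball_finite[of "0::'a"] by (subst emeasure_eq_ennreal_measure) (auto simp: less_top)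
    also have "ennreal (b k) * \<dots> = ennreal (b k * measure lborel (ball (0::'a) (\<rho> * 2 ^ Suc k)))"
      by (simp add: ennreal_mult b_nonneg)
    finally show "(\<integral>\<^sup>+x. ennreal (b k) * indicator (ball 0 (\<rho> * 2 ^ Suc k)) x \<partial>(lborel::'a measure))
                   = ennreal (2 ^ d * V / \<rho> powr s * (1 / 2 powr s) ^ k)"
      by (simp only: shell)
  qed
  also have "\<dots> < \<infinity>"
  proof -
    have "1 / 2 powr s < (1::real)" using \<open>s > 0\<close> by simp
    then have "summable (\<lambda>k. 2 ^ d * V / \<rho> powr s * (1 / 2 powr s) ^ k)"
      by (intro summable_mult summable_geometric) auto
    then have "(\<Sum>k. ennreal (2 ^ d * V / \<rho> powr s * (1 / 2 powr s) ^ k)) \<noteq> top"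
      by (intro ennreal_suminf_neq_top) (auto simp: V_def)
    then show ?thesis by (simp add: less_top)
  qed
  finally have "integrable lborel f"
    by (intro integrableI_bounded) auto
  then show ?thesis
    by (simp add: set_integrable_def f_def[abs_def] d_def)
qed

section \<open>Homogeneous kernels\<close>

text \<open>
  The density is assumed continuous only on the sphere, but \<open>sgn\<close> maps the complement of the origin
  there; at the origin the kernel is zero, since \<open>0 powr x = 0\<close> and division by zero gives
  zero.
\<close>
lemma borel_measurable_hom_kernel:
  fixes a :: "real ^ 'n::finite \<Rightarrow> real"
  assumes "admissible_density a"
  shows "hom_kernel a s \<in> borel_measurable borel"
proof -
  have "continuous_on (sphere 0 1) a"
    using assms by (simp add: admissible_density_def)
  moreover have "continuous_on (- {0}) (sgn :: real ^ 'n \<Rightarrow> real ^ 'n)"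
    by (intro continuous_on_sgn continuous_on_id) auto
  ultimately have "continuous_on (- {0}) (\<lambda>\<zeta>. a (sgn \<zeta>))"
    by (rule continuous_on_compose2) (auto simp: norm_sgn split: if_splits)
  then have "continuous_on (- {0}) (hom_kernel a s)"
    unfolding hom_kernel_def[abs_def]
    by (intro continuous_on_divide continuous_on_powr continuous_on_norm continuous_on_id continuous_on_const)
       auto
  then have "(\<lambda>\<zeta>. indicator (- {0}) \<zeta> *\<^sub>R hom_kernel a s \<zeta>) \<in> borel_measurable borel"
    by (intro borel_measurable_continuous_on_indicator) auto
  moreover have "(\<lambda>\<zeta>. indicator (- {0}) \<zeta> *\<^sub>R hom_kernel a s \<zeta>) = hom_kernel a s"
    by (auto simp: hom_kernel_def indicator_def fun_eq_iff)
  ultimately show ?thesis by simp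
qed

lemma hom_kernel_scaleR:
  fixes \<zeta> :: "real ^ 'n::finite"
  assumes "r > 0"
  shows "hom_kernel a s (r *\<^sub>R \<zeta>) = hom_kernel a s \<zeta> / r powr (real CARD('n) + s)"
  using assms by (simp add: hom_kernel_def sgn_scaleR powr_mult)

text \<open>
  The bound on the density compares the kernel with a pure power of the norm about the origin;
  the reflection \<open>y \<mapsto> v - y\<close> then moves the singularity to \<open>v\<close>.
\<close>
lemma set_integrable_hom_kernel_outside_ball:
  fixes v :: "real ^ 'n::finite"
  assumes a: "admissible_density a" and "s > 0" and "\<rho> > 0"
  shows "set_integrable lborel (- ball v \<rho>) (\<lambda>y. hom_kernel a s (v - y))"
proof -
  note [measurable] = borel_measurable_hom_kernel[OF a, of s]
  obtain C where C: "0 < C" "\<And>\<omega>. \<omega> \<in> sphere 0 1 \<Longrightarrow> \<bar>a \<omega>\<bar> \<le> C"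
    using a unfolding admissible_density_def by (smt (verit))
  have "set_integrable lborel (- ball 0 \<rho>) (hom_kernel a s)"
  proof (rule set_integrable_bound)
    show "set_integrable lborel (- ball 0 \<rho>)
            (\<lambda>x::real^'n. C * (1 / norm x powr (real DIM(real^'n) + s)))"
      using set_integrable_norm_powr_outside_ball[OF \<open>s > 0\<close> \<open>\<rho> > 0\<close>, where 'a = "real^'n"]
      by (intro set_integrable_mult_right) auto
    show "set_borel_measurable lborel (- ball 0 \<rho>) (hom_kernel a s)"
      unfolding set_borel_measurable_def by measurable
    have "\<bar>a (sgn x)\<bar> / norm x powr (real CARD('n) + s) \<le> C / norm x powr (real CARD('n) + s)"
      if "x \<in> - ball 0 \<rho>" for x :: "real^'n"
      using that \<open>\<rho> > 0\<close> by (intro divide_right_mono C) (auto simp: norm_sgn)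
    then show "AE x in lborel. x \<in> - ball 0 \<rho> \<longrightarrow> norm (hom_kernel a s x)
                 \<le> norm (C * (1 / norm x powr (real DIM(real^'n) + s)))"
      using \<open>C > 0\<close> by (intro AE_I2) (auto simp: hom_kernel_def abs_mult)
  qed
  then have "integrable lborel (\<lambda>x. indicator (- ball 0 \<rho>) x *\<^sub>R hom_kernel a s x)"
    by (simp add: set_integrable_def)
  from lborel_integrable_affine[OF this, of "-1" v]
  have "integrable lborel (\<lambda>y. indicator (- ball 0 \<rho>) (v - y) *\<^sub>R hom_kernel a s (v - y))"
    by simp
  moreover have "indicator (- ball 0 \<rho>) (v - y) = (indicator (- ball v \<rho>) y :: real)" for y
    by (simp add: indicator_def dist_norm norm_minus_commute)
  ultimately show ?thesis by (simp add: set_integrable_def)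
qed

text \<open>
  The Jacobian \<open>r ^ CARD('n)\<close> meets the homogeneity \<open>r powr (- (CARD('n) + s))\<close> of the kernel,
  which leaves the factor \<open>r powr (- s)\<close>. Both sides are truncated at corresponding radii so that
  the identity passes to principal values; with \<open>\<rho> = 0\<close> it covers untruncated integrals, as
  the balls are then empty.
\<close>
lemma set_integral_hom_kernel_similarity:
  fixes e t :: "real ^ 'n::finite"
  assumes a: "admissible_density a" and [measurable]: "T \<in> sets borel" and "r > 0"
    and inv: "\<And>x. t + r *\<^sub>R x \<in> T \<longleftrightarrow> x \<in> T"
  shows "(LINT y:T - ball (t + r *\<^sub>R e) (r * \<rho>)|lborel. hom_kernel a s (t + r *\<^sub>R e - y))
         = r powr (- s) * (LINT x:T - ball e \<rho>|lborel. hom_kernel a s (e - x))"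
proof -
  define f where "f y = indicator (T - ball (t + r *\<^sub>R e) (r * \<rho>)) y *\<^sub>R hom_kernel a s (t + r *\<^sub>R e - y)" for y
  have [measurable]: "(\<lambda>y. hom_kernel a s (t + r *\<^sub>R e - y)) \<in> borel_measurable borel"
    by (rule measurable_compose[OF _ borel_measurable_hom_kernel[OF a]]) simp
  have "f \<in> borel_measurable borel"
    unfolding f_def[abs_def] by (intro borel_measurable_scaleR borel_measurable_indicator) auto
  then have f_int: "integral\<^sup>L lborel f = r ^ CARD('n) * (LINT x|lborel. f (t + r *\<^sub>R x))"
    using lborel_integral_affine[of f r t] \<open>r > 0\<close> by simp
  have f: "f (t + r *\<^sub>R x) = (indicator (T - ball e \<rho>) x *\<^sub>R hom_kernel a s (e - x)) / r powr (real CARD('n) + s)" for x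
  proof -
    have diff: "t + r *\<^sub>R e - (t + r *\<^sub>R x) = r *\<^sub>R (e - x)"
      by (simp add: algebra_simps)
    then have "t + r *\<^sub>R x \<in> ball (t + r *\<^sub>R e) (r * \<rho>) \<longleftrightarrow> x \<in> ball e \<rho>"
      unfolding mem_ball dist_norm using \<open>r > 0\<close> by (simp add: dist_norm)
    then show ?thesis
      unfolding f_def diff hom_kernel_scaleR[OF \<open>r > 0\<close>] by (simp add: indicator_def inv)
  qed
  have "r ^ CARD('n) * x / r powr (real CARD('n) + s) = r powr (- s) * x" for x
    using \<open>r > 0\<close> by (simp add: powr_add powr_realpow powr_minus field_simps)
  then show ?thesis
    using f_int unfolding set_lebesgue_integral_def f_def[abs_def, symmetric] f by simp
qed

section \<open>Sectors\<close>

text \<open>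
  The two linear forms take the values \<open>\<rho> sin (\<beta> - \<theta>1)\<close> and \<open>\<rho> sin (\<theta>2 - \<beta>)\<close> at a point with
  polar coordinates \<open>\<rho>, \<beta>\<close>. For an opening of at most \<open>pi\<close> both are positive exactly when
  \<open>\<beta>\<close> lies strictly between the two angles. This presents sectors as open cones cut out by
  linear inequalities.
\<close>
lemma sector_eq_wedge:
  assumes "0 \<le> \<theta>1" and "\<theta>1 < \<theta>2" and "\<theta>2 \<le> pi"
  shows "sector p q \<theta>1 \<theta>2 =
           {x. x $ q * cos \<theta>1 - x $ p * sin \<theta>1 > 0 \<and> x $ p * sin \<theta>2 - x $ q * cos \<theta>2 > 0}"
proof (intro equalityI subsetI)
  fix x assume "x \<in> sector p q \<theta>1 \<theta>2"
  then obtain \<beta> \<rho> where \<beta>: "\<theta>1 < \<beta>" "\<beta> < \<theta>2" "\<rho> > 0"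
    and x: "x $ p = \<rho> * cos \<beta>" "x $ q = \<rho> * sin \<beta>"
    by (auto simp: sector_def)
  have "x $ q * cos \<theta>1 - x $ p * sin \<theta>1 = \<rho> * sin (\<beta> - \<theta>1)"
    "x $ p * sin \<theta>2 - x $ q * cos \<theta>2 = \<rho> * sin (\<theta>2 - \<beta>)"
    by (simp_all add: x sin_diff algebra_simps)
  moreover have "sin (\<beta> - \<theta>1) > 0" "sin (\<theta>2 - \<beta>) > 0"
    using \<beta> assms by (auto intro!: sin_gt_zero)
  ultimately show "x \<in> {x. x $ q * cos \<theta>1 - x $ p * sin \<theta>1 > 0 \<and> x $ p * sin \<theta>2 - x $ q * cos \<theta>2 > 0}"
    using \<open>\<rho> > 0\<close> by (simp del: diff_gt_0_iff_gt)
next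
  fix x :: "real ^ 'a"
  assume "x \<in> {x. x $ q * cos \<theta>1 - x $ p * sin \<theta>1 > 0 \<and> x $ p * sin \<theta>2 - x $ q * cos \<theta>2 > 0}"
  then have x: "x $ q * cos \<theta>1 - x $ p * sin \<theta>1 > 0" "x $ p * sin \<theta>2 - x $ q * cos \<theta>2 > 0"
    by auto
  define \<rho> where "\<rho> = sqrt ((x $ p)\<^sup>2 + (x $ q)\<^sup>2)"
  have "x $ p \<noteq> 0 \<or> x $ q \<noteq> 0" using x by auto
  then have "(x $ p)\<^sup>2 + (x $ q)\<^sup>2 > 0"
    by (simp add: sum_power2_gt_zero_iff)
  then have \<rho>: "\<rho> > 0" "\<rho>\<^sup>2 = (x $ p)\<^sup>2 + (x $ q)\<^sup>2"
    by (auto simp: \<rho>_def)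
  then have "(x $ p / \<rho>)\<^sup>2 + (x $ q / \<rho>)\<^sup>2 = 1"
    using \<open>x $ p \<noteq> 0 \<or> x $ q \<noteq> 0\<close> by (auto simp: power_divide add_divide_distrib[symmetric])
  then obtain \<beta> where \<beta>: "0 \<le> \<beta>" "\<beta> < 2 * pi" "x $ p / \<rho> = cos \<beta>" "x $ q / \<rho> = sin \<beta>"
    by (rule sincos_total_2pi)
  then have xp: "x $ p = \<rho> * cos \<beta>" "x $ q = \<rho> * sin \<beta>"
    using \<rho>(1) by (auto simp: field_simps)
  have "\<rho> * sin (\<beta> - \<theta>1) > 0" "\<rho> * sin (\<theta>2 - \<beta>) > 0"
    using x by (simp_all add: xp sin_diff algebra_simps)
  then have s: "sin (\<beta> - \<theta>1) > 0" "sin (\<theta>2 - \<beta>) > 0"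
    using \<rho>(1) by (simp_all add: zero_less_mult_iff)
  \<comment> \<open>The polar angle was only chosen in a full period; the signs of the sines now locate it.\<close>
  have "\<theta>1 < \<beta>"
  proof (rule ccontr)
    assume "\<not> \<theta>1 < \<beta>"
    then have "sin (\<theta>1 - \<beta>) \<ge> 0"
      using assms \<beta> by (intro sin_ge_zero) auto
    with s(1) show False using sin_minus[of "\<beta> - \<theta>1"] by simp
  qed
  moreover have "\<beta> < \<theta>1 + pi"
  proof (rule ccontr)
    assume "\<not> \<beta> < \<theta>1 + pi"
    then have "sin (\<beta> - \<theta>1 - pi) \<ge> 0"
      using assms \<beta> by (intro sin_ge_zero) auto
    with s(1) show False by (simp add: sin_diff)
  qed
  moreover have "\<beta> < \<theta>2"
  proof (rule ccontr)
    assume "\<not> \<beta> < \<theta>2"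
    then have "sin (\<beta> - \<theta>2) \<ge> 0"
      using assms \<open>\<beta> < \<theta>1 + pi\<close> by (intro sin_ge_zero) auto
    with s(2) show False using sin_minus[of "\<theta>2 - \<beta>"] by simp
  qed
  ultimately show "x \<in> sector p q \<theta>1 \<theta>2"
    using \<rho>(1) xp by (auto simp: sector_def)
qed

lemma open_sector:
  assumes "0 \<le> \<theta>1" and "\<theta>1 < \<theta>2" and "\<theta>2 \<le> pi"
  shows "open (sector p q \<theta>1 \<theta>2)"
  unfolding sector_eq_wedge[OF assms]
  by (intro open_Collect_conj open_Collect_less continuous_intros)

lemma sector_similarity_invariant:
  assumes "0 \<le> \<theta>1" and "\<theta>1 < \<theta>2" and "\<theta>2 \<le> pi"
    and "t $ p = 0" and "t $ q = 0" and "r > 0"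
  shows "t + r *\<^sub>R x \<in> sector p q \<theta>1 \<theta>2 \<longleftrightarrow> x \<in> sector p q \<theta>1 \<theta>2"
proof -
  have "(t + r *\<^sub>R x) $ q * c - (t + r *\<^sub>R x) $ p * d = r * (x $ q * c - x $ p * d)"
    "(t + r *\<^sub>R x) $ p * c - (t + r *\<^sub>R x) $ q * d = r * (x $ p * c - x $ q * d)" for c d
    using assms by (simp_all add: algebra_simps)
  then show ?thesis
    using \<open>r > 0\<close> unfolding sector_eq_wedge[OF assms(1-3)] mem_Collect_eq
    by (simp only: zero_less_mult_iff) auto
qed

lemma disjoint_sectors:
  assumes "\<theta> \<in> {0<..<pi}"
  shows "sector p q 0 \<theta> \<inter> sector p q \<theta> pi = {}"
  using assms by (auto simp: sector_eq_wedge)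

text \<open>
  The two sides can differ only on the common face of the two sectors, which lies in the
  hyperplane on which \<open>x $ q * cos \<theta> = x $ p * sin \<theta>\<close>.
\<close>
lemma AE_sector_cut:
  fixes p q :: "'n::finite"
  assumes "p \<noteq> q" and "\<theta> \<in> {0<..<pi}"
  shows "AE x in lborel. x \<in> sector p q 0 pi \<longleftrightarrow> x \<in> sector p q 0 \<theta> \<or> x \<in> sector p q \<theta> pi"
proof -
  have "sin \<theta> > 0" using assms by (intro sin_gt_zero) auto
  define w :: "real ^ 'n" where "w = cos \<theta> *\<^sub>R axis q 1 - sin \<theta> *\<^sub>R axis p 1"
  have w: "w \<bullet> x = x $ q * cos \<theta> - x $ p * sin \<theta>" for x
    by (simp add: w_def inner_diff_left inner_axis')
  have "w $ p = - sin \<theta>" using \<open>p \<noteq> q\<close> by (simp add: w_def axis_def)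
  then have "w \<noteq> 0" using \<open>sin \<theta> > 0\<close> by auto
  then have "negligible {x. w \<bullet> x = 0}"
    by (intro negligible_hyperplane) auto
  then have "AE x in lborel. w \<bullet> x \<noteq> 0"
    unfolding negligible_iff_null_sets by (auto dest!: AE_not_in simp: AE_completion_iff)
  then show ?thesis
  proof (rule eventually_mono)
    fix x assume "w \<bullet> x \<noteq> 0"
    moreover have "x $ q > 0" if "x $ p * sin \<theta> - x $ q * cos \<theta> > 0" "x $ q * cos 0 - x $ p * sin 0 > 0"
      using that by simp
    ultimately show "x \<in> sector p q 0 pi \<longleftrightarrow> x \<in> sector p q 0 \<theta> \<or> x \<in> sector p q \<theta> pi"
      using assms unfolding w by (auto simp: sector_eq_wedge)
  qed
qed

text \<open>
  If the polar angle of \<open>v\<close> were less than \<open>\<theta>\<close>, then \<open>v\<close> would belong to the open set \<open>V\<close>. If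
  it were greater, then the open sector beyond \<open>\<theta>\<close> would be a neighbourhood of \<open>v\<close> that
  misses \<open>V\<close>.
\<close>
lemma frontier_point_on_ray:
  assumes "p \<noteq> q" and \<theta>: "\<theta> \<in> {0<..<pi}" and "open V"
    and cut: "sector p q 0 pi \<inter> V = sector p q 0 \<theta>"
    and v: "v \<in> sector p q 0 pi" "v \<in> frontier V"
  obtains t r where "v = t + r *\<^sub>R edir p q \<theta>" "t $ p = 0" "t $ q = 0" "r > 0"
proof -
  obtain \<beta> r where \<beta>: "0 < \<beta>" "\<beta> < pi" "r > 0" and vp: "v $ p = r * cos \<beta>" "v $ q = r * sin \<beta>"
    using v(1) by (auto simp: sector_def)
  have "v \<notin> V" "v \<in> closure V"
    using v(2) \<open>open V\<close> by (auto simp: frontier_def interior_open)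
  have "\<not> \<beta> < \<theta>"
  proof
    assume "\<beta> < \<theta>"
    then have "v \<in> sector p q 0 \<theta>"
      using \<beta> vp by (auto simp: sector_def)
    with cut \<open>v \<notin> V\<close> show False by auto
  qed
  moreover have "\<not> \<theta> < \<beta>"
  proof
    assume "\<theta> < \<beta>"
    then have "v \<in> sector p q \<theta> pi"
      using \<beta> vp by (auto simp: sector_def)
    moreover have "open (sector p q \<theta> pi)"
      using \<theta> by (intro open_sector) auto
    ultimately obtain x where x: "x \<in> V" "x \<in> sector p q \<theta> pi"
      using \<open>v \<in> closure V\<close> by (meson closure_iff_nhds_not_empty disjoint_iff order_refl)
    moreover have "sector p q \<theta> pi \<subseteq> sector p q 0 pi"
      using \<theta> unfolding sector_def by force
    ultimately show False
      using cut disjoint_sectors[OF \<theta>, of p q] by auto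
  qed
  ultimately have "\<beta> = \<theta>" by simp
  show ?thesis
  proof
    show "v = (v - r *\<^sub>R edir p q \<theta>) + r *\<^sub>R edir p q \<theta>" by simp
    show "(v - r *\<^sub>R edir p q \<theta>) $ p = 0" "(v - r *\<^sub>R edir p q \<theta>) $ q = 0"
      using \<open>p \<noteq> q\<close> by (simp_all add: edir_def axis_def vp \<open>\<beta> = \<theta>\<close>)
  qed (fact \<open>r > 0\<close>)
qed

section \<open>The curvature equation at a point of the face\<close>

text \<open>
  Almost everywhere off \<open>S\<close> and \<open>S'\<close> one is outside the upper half-space, where removing the
  ball changes nothing because the ball lies inside the half-space. The removal of the ball makes
  all three integrals absolutely convergent, so they can be separated.
\<close>
lemma truncated_curvature_split:
  fixes p q :: "'n::finite"
  assumes "p \<noteq> q" and \<theta>: "\<theta> \<in> {0<..<pi}" and a: "admissible_density a" and "s > 0"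
    and "\<rho> > 0" and ball: "ball v \<rho> \<subseteq> sector p q 0 pi"
  defines "K \<equiv> hom_kernel a s" and "S \<equiv> sector p q 0 \<theta>" and "S' \<equiv> sector p q \<theta> pi"
  shows "(LINT y:- ball v \<rho>|lborel. K (v - y) * (indicator (- S) y - indicator S y))
       = (LINT y:S' - ball v \<rho>|lborel. K (v - y)) - (LINT y:S - ball v \<rho>|lborel. K (v - y))
         + (LINT y:- sector p q 0 pi|lborel. K (v - y))"
proof -
  let ?H = "sector p q 0 pi"
  have "open ?H" "open S" "open S'"
    unfolding S_def S'_def using \<theta> by (auto intro!: open_sector)
  then have meas: "- ?H \<in> sets lborel" "S - ball v \<rho> \<in> sets lborel" "S' - ball v \<rho> \<in> sets lborel"
    by auto
  have int: "set_integrable lborel (- ball v \<rho>) (\<lambda>y. K (v - y))"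
    unfolding K_def by (rule set_integrable_hom_kernel_outside_ball[OF a \<open>s > 0\<close> \<open>\<rho> > 0\<close>])
  have ints: "integrable lborel (\<lambda>y. indicator T y *\<^sub>R K (v - y))"
    if "T \<in> sets lborel" "T \<subseteq> - ball v \<rho>" for T
    using set_integrable_subset[OF int that] by (simp add: set_integrable_def)
  have i1: "integrable lborel (\<lambda>y. indicator (S' - ball v \<rho>) y *\<^sub>R K (v - y))"
    and i2: "integrable lborel (\<lambda>y. indicator (S - ball v \<rho>) y *\<^sub>R K (v - y))"
    and i3: "integrable lborel (\<lambda>y. indicator (- ?H) y *\<^sub>R K (v - y))"
    by (rule ints; use meas ball in blast)+
  let ?g = "\<lambda>y. indicator (S' - ball v \<rho>) y *\<^sub>R K (v - y) - indicator (S - ball v \<rho>) y *\<^sub>R K (v - y)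
                + indicator (- ?H) y *\<^sub>R K (v - y)"
  have "integral\<^sup>L lborel ?g = (LINT y:S' - ball v \<rho>|lborel. K (v - y)) - (LINT y:S - ball v \<rho>|lborel. K (v - y))
         + (LINT y:- ?H|lborel. K (v - y))"
    unfolding set_lebesgue_integral_def
    by (simp only: Bochner_Integration.integral_add[OF Bochner_Integration.integrable_diff[OF i1 i2] i3]
        Bochner_Integration.integral_diff[OF i1 i2])
  moreover have "(LINT y:- ball v \<rho>|lborel. K (v - y) * (indicator (- S) y - indicator S y)) = integral\<^sup>L lborel ?g"
    unfolding set_lebesgue_integral_def
  proof (rule integral_cong_AE)
    have [measurable]: "(\<lambda>y. K (v - y)) \<in> borel_measurable borel"
      unfolding K_def by (rule measurable_compose[OF _ borel_measurable_hom_kernel[OF a]]) simp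
    have [measurable]: "S \<in> sets borel" using \<open>open S\<close> by auto
    show "(\<lambda>y. indicator (- ball v \<rho>) y *\<^sub>R (K (v - y) * (indicator (- S) y - indicator S y))) \<in> borel_measurable lborel"
      by simp
    show "?g \<in> borel_measurable lborel"
      using i1 i2 i3 by (intro borel_measurable_add borel_measurable_diff borel_measurable_integrable)
    show "AE y in lborel. indicator (- ball v \<rho>) y *\<^sub>R (K (v - y) * (indicator (- S) y - indicator S y)) = ?g y"
      using AE_sector_cut[OF \<open>p \<noteq> q\<close> \<theta>]
    proof (rule eventually_mono)
      fix y assume cut: "y \<in> ?H \<longleftrightarrow> y \<in> sector p q 0 \<theta> \<or> y \<in> sector p q \<theta> pi"
      have "y \<notin> S \<or> y \<notin> S'"
        using disjoint_sectors[OF \<theta>, of p q] by (auto simp: S_def S'_def)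
      then show "indicator (- ball v \<rho>) y *\<^sub>R (K (v - y) * (indicator (- S) y - indicator S y)) = ?g y"
        using cut ball unfolding S_def[symmetric] S'_def[symmetric]
        by (auto simp: indicator_def)
    qed
  qed
  ultimately show ?thesis by simp
qed

theorem proposition1p9:
  fixes p q :: "'n::finite"
    and a1 a2 :: "real ^ 'n \<Rightarrow> real"
    and s1 s2 \<sigma> \<theta> :: real
    and H V :: "(real ^ 'n) set"
  assumes "CARD('n) \<ge> 2" and "p \<noteq> q"
    and "s1 \<in> {0<..<1}" and "s2 \<in> {0<..<1}"
    and "admissible_density a1" and "admissible_density a2"
    and "s1 = s2 \<or> \<sigma> = 0"
    and "open_halfspace H" and "H = sector p q 0 pi"
    and "open_halfspace V"
    and "\<theta> \<in> {0<..<pi}" and "H \<inter> V = sector p q 0 \<theta>"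
    and "\<exists>v \<in> H \<inter> frontier V. \<exists>h.
           has_mean_curvature (hom_kernel a1 s1) (H \<inter> V) v h \<and>
           h - (LINT z:- H|lborel. hom_kernel a1 s1 (v - z))
             + \<sigma> * (LINT z:- H|lborel. hom_kernel a2 s2 (v - z)) = 0"
  shows "\<exists>L. ((\<lambda>\<rho>.
             (LINT x:sector p q \<theta> pi - ball (edir p q \<theta>) \<rho>|lborel.
                a1 (sgn (edir p q \<theta> - x)) / norm (edir p q \<theta> - x) powr (real CARD('n) + s1))
           - (LINT x:sector p q 0 \<theta> - ball (edir p q \<theta>) \<rho>|lborel.
                a1 (sgn (edir p q \<theta> - x)) / norm (edir p q \<theta> - x) powr (real CARD('n) + s1)))
             \<longlongrightarrow> L) (at_right 0) \<and>
           L + \<sigma> * (LINT x:- H|lborel.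
                a2 (sgn (edir p q \<theta> - x)) / norm (edir p q \<theta> - x) powr (real CARD('n) + s1)) = 0"
proof -
  note \<theta> = \<open>\<theta> \<in> {0<..<pi}\<close> and a1 = \<open>admissible_density a1\<close> and a2 = \<open>admissible_density a2\<close>
    and H = \<open>H = sector p q 0 pi\<close> and HV = \<open>H \<inter> V = sector p q 0 \<theta>\<close>
  define e where "e = edir p q \<theta>"
  define D where "D x \<rho> = (LINT y:sector p q \<theta> pi - ball x \<rho>|lborel. hom_kernel a1 s1 (x - y))
                         - (LINT y:sector p q 0 \<theta> - ball x \<rho>|lborel. hom_kernel a1 s1 (x - y))" for x \<rho>
  obtain v h where v: "v \<in> H" "v \<in> frontier V"
    and curv: "has_mean_curvature (hom_kernel a1 s1) (sector p q 0 \<theta>) v h"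
    and eq: "h - (LINT z:- H|lborel. hom_kernel a1 s1 (v - z))
             + \<sigma> * (LINT z:- H|lborel. hom_kernel a2 s2 (v - z)) = 0"
    using assms(13) unfolding HV by auto
  have "open V"
    using \<open>open_halfspace V\<close> by (auto simp: open_halfspace_def open_halfspace_lt)
  then obtain t r where vr: "v = t + r *\<^sub>R e" and t: "t $ p = 0" "t $ q = 0" and "r > 0"
    using frontier_point_on_ray[OF \<open>p \<noteq> q\<close> \<theta>, of V v] HV v unfolding H e_def by metis
  have "open H" unfolding H by (intro open_sector) auto
  have sets: "sector p q \<theta> pi \<in> sets borel" "sector p q 0 \<theta> \<in> sets borel" "- H \<in> sets borel"
    using \<theta> \<open>open H\<close> by (auto intro!: open_sector borel_open)
  have inv: "t + r *\<^sub>R x \<in> sector p q \<theta> pi \<longleftrightarrow> x \<in> sector p q \<theta> pi"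
    "t + r *\<^sub>R x \<in> sector p q 0 \<theta> \<longleftrightarrow> x \<in> sector p q 0 \<theta>"
    "t + r *\<^sub>R x \<in> - H \<longleftrightarrow> x \<in> - H" for x
    using \<theta> t \<open>r > 0\<close> unfolding H by (simp_all add: sector_similarity_invariant)
  obtain \<delta> where "\<delta> > 0" and \<delta>: "ball v \<delta> \<subseteq> H"
    using \<open>open H\<close> \<open>v \<in> H\<close> openE by blast
  define L where "L = h - (LINT z:- H|lborel. hom_kernel a1 s1 (v - z))"
  have "eventually (\<lambda>\<rho>. (LINT y:- ball v \<rho>|lborel. hom_kernel a1 s1 (v - y) *
            (indicator (- sector p q 0 \<theta>) y - indicator (sector p q 0 \<theta>) y))
          - (LINT z:- H|lborel. hom_kernel a1 s1 (v - z)) = D v \<rho>) (at_right 0)"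
    using eventually_at_right_less[of 0] eventually_at_right_real[OF \<open>\<delta> > 0\<close>]
  proof eventually_elim
    case (elim \<rho>)
    then have "ball v \<rho> \<subseteq> sector p q 0 pi" using \<delta> H by force
    with elim show ?case
      using truncated_curvature_split[OF \<open>p \<noteq> q\<close> \<theta> a1, of s1 \<rho> v] \<open>s1 \<in> {0<..<1}\<close>
      by (simp add: D_def H)
  qed
  moreover have "((\<lambda>\<rho>. (LINT y:- ball v \<rho>|lborel. hom_kernel a1 s1 (v - y) *
            (indicator (- sector p q 0 \<theta>) y - indicator (sector p q 0 \<theta>) y))
          - (LINT z:- H|lborel. hom_kernel a1 s1 (v - z))) \<longlongrightarrow> L) (at_right 0)"
    using curv unfolding has_mean_curvature_def L_def by (intro tendsto_intros)
  ultimately have "(D v \<longlongrightarrow> L) (at_right 0)"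
    by (rule Lim_transform_eventually[rotated])
  \<comment> \<open>A ball of radius \<open>\<rho>\<close> about \<open>e\<close> corresponds to one of radius \<open>r * \<rho>\<close> about \<open>v\<close>.\<close>
  moreover have "filterlim (\<lambda>\<rho>. r * \<rho>) (at_right 0) (at_right 0)"
    using \<open>r > 0\<close> by (intro filterlim_times_pos[OF filterlim_ident]) auto
  ultimately have "((\<lambda>\<rho>. D v (r * \<rho>)) \<longlongrightarrow> L) (at_right 0)"
    by (rule filterlim_compose)
  moreover have scale: "D v (r * \<rho>) = r powr (- s1) * D e \<rho>" for \<rho>
    unfolding D_def vr
    using set_integral_hom_kernel_similarity[OF a1 sets(1) \<open>r > 0\<close> inv(1), where s = s1 and e = e]
      set_integral_hom_kernel_similarity[OF a1 sets(2) \<open>r > 0\<close> inv(2), where s = s1 and e = e]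
    by (simp add: right_diff_distrib)
  ultimately have "((\<lambda>\<rho>. r powr s1 * (r powr (- s1) * D e \<rho>)) \<longlongrightarrow> r powr s1 * L) (at_right 0)"
    by (intro tendsto_intros) simp
  then have lim: "(D e \<longlongrightarrow> r powr s1 * L) (at_right 0)"
    using \<open>r > 0\<close> by (simp add: mult.assoc[symmetric] powr_add[symmetric])
  have "\<sigma> * (LINT z:- H|lborel. hom_kernel a2 s2 (v - z))
        = r powr (- s1) * (\<sigma> * (LINT x:- H|lborel. hom_kernel a2 s1 (e - x)))"
    using set_integral_hom_kernel_similarity[OF a2 sets(3) \<open>r > 0\<close> inv(3), where s = s1 and e = e and \<rho> = 0]
      \<open>s1 = s2 \<or> \<sigma> = 0\<close> by (auto simp: vr)
  then have "L + r powr (- s1) * (\<sigma> * (LINT x:- H|lborel. hom_kernel a2 s1 (e - x))) = 0"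
    using eq unfolding L_def by linarith
  then have "r powr s1 * L + r powr s1 * r powr (- s1) * (\<sigma> * (LINT x:- H|lborel. hom_kernel a2 s1 (e - x))) = 0"
    by (metis distrib_left mult.assoc mult_zero_right)
  then have "r powr s1 * L + \<sigma> * (LINT x:- H|lborel. hom_kernel a2 s1 (e - x)) = 0"
    using \<open>r > 0\<close> by (simp add: powr_add[symmetric])
  with lim show ?thesis
    unfolding D_def hom_kernel_def e_def by blast
qed

end
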